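(* Let $F$ be a field with $p^f>3$ elements ($p$ prime) and let $q$ be an odd prime divisor of $p^f-1$. Let $B=\langle b\rangle$ be the cyclic group of order $q$. Then $$|V_{+}(FB)| = |V_{*}(FB)| = |F^{\times}|^{\frac{q-1}{2}}$$ and $$(V(FB))_{2'} = (V_{+}(FB))_{2'}\times (V_{*}(FB))_{2'}$$ (internal direct product).
   Context: $FB$ is the group algebra and $V(FB)$ is the group of units of $FB$ of augmentation $1$, where the augmentation map is $\sum_{g}\alpha_g g\mapsto\sum_g\alpha_g$. The map $*$ is the $F$-linear anti-automorphism of $FB$ with $g^*=g^{-1}$ for $g\in B$. The unitary subgroup is $V_{*}(FB)=\{u\in V(FB): u^*=u^{-1}\}$, and the symmetric subgroup (a group because $B$ is abelian) is $V_{+}(FB)=\{u\in V(FB): u^*=u\}$. For a finite solvable group $K$, $K_{2'}$ denotes its Hall $2'$-subgroup (here the groups are abelian, so it is the subgroup of elements of odd order). *)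

theory Defs
  imports "HOL-Algebra.Algebra"
begin

hide_const (open) Divisibility.prime

section \<open>Group algebras\<close>

definition group_algebra ::
    "('a, 'm) ring_scheme \<Rightarrow> ('g, 'n) monoid_scheme \<Rightarrow> ('g \<Rightarrow> 'a) ring" where
  "group_algebra R G =
    \<lparr>carrier = {u \<in> carrier G \<rightarrow>\<^sub>E carrier R. finite {g \<in> carrier G. u g \<noteq> \<zero>\<^bsub>R\<^esub>}},
     monoid.mult = (\<lambda>u v. \<lambda>x\<in>carrier G.
       \<Oplus>\<^bsub>R\<^esub>y\<in>{g \<in> carrier G. u g \<noteq> \<zero>\<^bsub>R\<^esub>}. u y \<otimes>\<^bsub>R\<^esub> v (inv\<^bsub>G\<^esub> y \<otimes>\<^bsub>G\<^esub> x)),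
     monoid.one = (\<lambda>x\<in>carrier G. if x = \<one>\<^bsub>G\<^esub> then \<one>\<^bsub>R\<^esub> else \<zero>\<^bsub>R\<^esub>),
     ring.zero = (\<lambda>x\<in>carrier G. \<zero>\<^bsub>R\<^esub>),
     ring.add = (\<lambda>u v. \<lambda>x\<in>carrier G. u x \<oplus>\<^bsub>R\<^esub> v x)\<rparr>"

definition augmentation ::
    "('a, 'm) ring_scheme \<Rightarrow> ('g, 'n) monoid_scheme \<Rightarrow> ('g \<Rightarrow> 'a) \<Rightarrow> 'a" where
  "augmentation R G u = (\<Oplus>\<^bsub>R\<^esub>g\<in>{g \<in> carrier G. u g \<noteq> \<zero>\<^bsub>R\<^esub>}. u g)"

text \<open>The linear extension of \<open>g \<mapsto> g\<^sup>-\<^sup>1\<close>: the coefficient of \<open>g\<close> in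
  \<open>\<Sum> u\<^sub>h h\<^sup>-\<^sup>1\<close> is the coefficient of \<open>g\<^sup>-\<^sup>1\<close> in \<open>u\<close>.\<close>

definition star :: "('g, 'n) monoid_scheme \<Rightarrow> ('g \<Rightarrow> 'a) \<Rightarrow> 'g \<Rightarrow> 'a" where
  "star G u = (\<lambda>g\<in>carrier G. u (inv\<^bsub>G\<^esub> g))"

definition normalized_units ::
    "('a, 'm) ring_scheme \<Rightarrow> ('g, 'n) monoid_scheme \<Rightarrow> ('g \<Rightarrow> 'a) monoid" where
  "normalized_units R G =
    (units_of (group_algebra R G))
      \<lparr>carrier := {u \<in> Units (group_algebra R G). augmentation R G u = \<one>\<^bsub>R\<^esub>}\<rparr>"

definition unitary_units ::
    "('a, 'm) ring_scheme \<Rightarrow> ('g, 'n) monoid_scheme \<Rightarrow> ('g \<Rightarrow> 'a) monoid" where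
  "unitary_units R G = (normalized_units R G)
    \<lparr>carrier := {u \<in> carrier (normalized_units R G). star G u = inv\<^bsub>normalized_units R G\<^esub> u}\<rparr>"

definition symmetric_units ::
    "('a, 'm) ring_scheme \<Rightarrow> ('g, 'n) monoid_scheme \<Rightarrow> ('g \<Rightarrow> 'a) monoid" where
  "symmetric_units R G = (normalized_units R G)
    \<lparr>carrier := {u \<in> carrier (normalized_units R G). star G u = u}\<rparr>"


section \<open>Hall subgroups and internal direct products\<close>

definition hall_subgroup :: "nat set \<Rightarrow> 'g set \<Rightarrow> ('g, 'n) monoid_scheme \<Rightarrow> bool" where
  "hall_subgroup \<pi> H K \<longleftrightarrow> subgroup H K \<and>
     (\<forall>r. prime r \<longrightarrow> r dvd card H \<longrightarrow> r \<in> \<pi>) \<and>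
     (\<forall>r. prime r \<longrightarrow> r dvd card (rcosets\<^bsub>K\<^esub> H) \<longrightarrow> r \<notin> \<pi>)"

text \<open>The Hall \<open>2'\<close>-subgroup of a finite group.
  In a solvable group Hall subgroups are in general unique only up to conjugacy; in a
  finite abelian group the description is definite, see \<open>hall_odd_eq\<close> below.\<close>

definition hall_odd :: "('g, 'n) monoid_scheme \<Rightarrow> 'g set" where
  "hall_odd K = (THE H. hall_subgroup {r. prime r \<and> r \<noteq> 2} H K)"

definition internal_direct_product ::
    "('g, 'n) monoid_scheme \<Rightarrow> 'g set \<Rightarrow> 'g set \<Rightarrow> bool" where
  "internal_direct_product G H K \<longleftrightarrow>
     H \<lhd> G \<and> K \<lhd> G \<and> H \<inter> K = {\<one>\<^bsub>G\<^esub>} \<and> H <#>\<^bsub>G\<^esub> K = carrier G"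

lemma (in group) exists_ord_prime:
  assumes "finite (carrier G)" "prime (r::nat)" "r dvd order G"
  shows "\<exists>x\<in>carrier G. ord x = r"
proof -
  obtain m where m: "order G = r ^ 1 * m" using assms(3) by auto
  obtain P where P: "subgroup P G" "card P = r"
    using sylow_thm[OF assms(2) group_axioms m assms(1)] by auto
  have "finite P" using P(1) assms(1) by (meson finite_subset subgroup.subset)
  have "P \<noteq> {\<one>}" using P(2) assms(2) by auto
  then obtain x where x: "x \<in> P" "x \<noteq> \<one>"
    using subgroup.one_closed[OF P(1)] by blast
  have xc: "x \<in> carrier G" using x(1) P(1) by (meson subgroup.mem_carrier)
  interpret P: group "G\<lparr>carrier := P\<rparr>" by (rule subgroup_imp_group[OF P(1)])
  have "x [^]\<^bsub>G\<lparr>carrier := P\<rparr>\<^esub> order (G\<lparr>carrier := P\<rparr>) = \<one>\<^bsub>G\<lparr>carrier := P\<rparr>\<^esub>"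
    by (rule P.pow_order_eq_1) (use x in auto)
  then have "x [^] r = \<one>"
    by (simp add: order_def P(2) nat_pow_consistent[symmetric])
  then have "ord x dvd r" using pow_eq_id xc by blast
  moreover have "ord x \<noteq> 1" using ord_eq_1 xc x(2) by blast
  ultimately have "ord x = r" using assms(2) by (auto simp: prime_nat_iff)
  with xc show ?thesis by blast
qed

lemma hall_odd_eq:
  assumes "comm_group K" and fin: "finite (carrier K)"
  shows "hall_odd K = {x \<in> carrier K. odd (group.ord K x)}"
    and "hall_subgroup {r. prime r \<and> r \<noteq> 2} H K \<longleftrightarrow> H = {x \<in> carrier K. odd (group.ord K x)}"
proof -
  interpret K: comm_group K by fact
  let ?O = "{x \<in> carrier K. odd (K.ord x)}"
  have oddI: "x \<in> ?O" if "x \<in> carrier K" "x [^]\<^bsub>K\<^esub> n = \<one>\<^bsub>K\<^esub>" "odd n" for x and n :: nat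
    using that K.pow_eq_id[OF that(1), of n] by (auto elim: dvd_trans)
  have sub: "subgroup ?O K"
  proof (rule K.subgroupI)
    show "?O \<noteq> {}" using oddI[of "\<one>\<^bsub>K\<^esub>" 1] by auto
    show "inv\<^bsub>K\<^esub> a \<in> ?O" if "a \<in> ?O" for a
      using that K.pow_ord_eq_1[of a]
      by (intro oddI[of _ "K.ord a"]) (auto simp: K.nat_pow_inv)
    show "a \<otimes>\<^bsub>K\<^esub> b \<in> ?O" if "a \<in> ?O" "b \<in> ?O" for a b
    proof (rule oddI[of _ "K.ord a * K.ord b"])
      have "a [^]\<^bsub>K\<^esub> (K.ord a * K.ord b) = \<one>\<^bsub>K\<^esub>" "b [^]\<^bsub>K\<^esub> (K.ord a * K.ord b) = \<one>\<^bsub>K\<^esub>"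
        using that K.pow_eq_id by auto
      then show "(a \<otimes>\<^bsub>K\<^esub> b) [^]\<^bsub>K\<^esub> (K.ord a * K.ord b) = \<one>\<^bsub>K\<^esub>"
        using that by (simp add: K.nat_pow_distrib)
    qed (use that in auto)
  qed auto
  have odd_ord: "r \<noteq> 2" if r: "prime r" "r dvd card ?O" for r
  proof
    assume "r = 2"
    interpret O: group "K\<lparr>carrier := ?O\<rparr>" by (rule K.subgroup_imp_group[OF sub])
    obtain x where x: "x \<in> ?O" "O.ord x = 2"
      using O.exists_ord_prime[of r] r fin \<open>r = 2\<close> by (auto simp: order_def)
    have "x [^]\<^bsub>K\<lparr>carrier := ?O\<rparr>\<^esub> (K.ord x) = \<one>\<^bsub>K\<^esub>"
      using x K.pow_ord_eq_1[of x] by (simp add: K.nat_pow_consistent[symmetric])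
    then have "O.ord x dvd K.ord x"
      using O.pow_eq_id[of x "K.ord x"] x by simp
    then show False using x by simp
  qed
  have odd_index: "r = 2" if r: "prime r" "r dvd card (rcosets\<^bsub>K\<^esub> ?O)" for r
  proof (rule ccontr)
    assume "r \<noteq> 2"
    then have "odd r" using r(1) by (metis primes_dvd_imp_eq two_is_prime_nat)
    have N: "?O \<lhd> K" by (rule K.subgroup_imp_normal[OF sub])
    have Q: "group (K Mod ?O)" by (rule normal.factorgroup_is_group[OF N])
    have finQ: "finite (carrier (K Mod ?O))"
      unfolding carrier_FactGroup using fin by (rule finite_imageI)
    have "r dvd order (K Mod ?O)"
      using r(2) by (simp only: order_def FactGroup_def partial_object.simps)
    then have "\<exists>C\<in>carrier (K Mod ?O). group.ord (K Mod ?O) C = r"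
      by (rule group.exists_ord_prime[OF Q finQ r(1)])
    then obtain C where C: "C \<in> carrier (K Mod ?O)" "group.ord (K Mod ?O) C = r"
      by blast
    then obtain x where x: "x \<in> carrier K" "C = ?O #>\<^bsub>K\<^esub> x"
      unfolding carrier_FactGroup by blast
    have "C [^]\<^bsub>K Mod ?O\<^esub> r = ?O" 
      using group.pow_ord_eq_1[OF Q C(1)] unfolding C(2) one_FactGroup .
    then have "?O #>\<^bsub>K\<^esub> (x [^]\<^bsub>K\<^esub> r) = ?O" 
      unfolding x(2) normal.FactGroup_pow[OF N x(1)] .
    then have "x [^]\<^bsub>K\<^esub> r \<in> ?O"
      using K.rcos_self[OF K.nat_pow_closed[OF x(1)] sub, of r] by metis
    then have "x [^]\<^bsub>K\<^esub> (r * K.ord (x [^]\<^bsub>K\<^esub> r)) = \<one>\<^bsub>K\<^esub>" "odd (r * K.ord (x [^]\<^bsub>K\<^esub> r))"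
      using x \<open>odd r\<close> K.pow_ord_eq_1[of "x [^]\<^bsub>K\<^esub> r"]
      by (auto simp: K.nat_pow_pow[symmetric])
    then have "x \<in> ?O" using oddI x by blast
    then have "C = ?O" using x K.coset_join2 sub by blast
    then have "group.ord (K Mod ?O) C = 1" 
      using group.ord_eq_1[OF Q C(1)] one_FactGroup by metis
    then show False using C(2) r(1) by (metis not_prime_1)
  qed
  have ex: "hall_subgroup {r. prime r \<and> r \<noteq> 2} ?O K"
    unfolding hall_subgroup_def using sub odd_ord odd_index by auto
  have uniq: "H = ?O" if H: "hall_subgroup {r. prime r \<and> r \<noteq> 2} H K" for H
  proof
    have sH: "subgroup H K" using H by (simp add: hall_subgroup_def)
    have HO: "odd (card H)" using H two_is_prime_nat unfolding hall_subgroup_def by blast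
    show "H \<subseteq> ?O"
    proof
      fix x assume x: "x \<in> H"
      interpret H: group "K\<lparr>carrier := H\<rparr>" by (rule K.subgroup_imp_group[OF sH])
      have "x [^]\<^bsub>K\<lparr>carrier := H\<rparr>\<^esub> order (K\<lparr>carrier := H\<rparr>) = \<one>\<^bsub>K\<lparr>carrier := H\<rparr>\<^esub>"
        by (rule H.pow_order_eq_1) (use x in auto)
      then have "x [^]\<^bsub>K\<^esub> card H = \<one>\<^bsub>K\<^esub>"
        by (simp add: order_def K.nat_pow_consistent[symmetric])
      then show "x \<in> ?O" using oddI HO x sH by (meson subgroup.mem_carrier)
    qed
    show "?O \<subseteq> H"
    proof
      fix x assume x: "x \<in> ?O"
      have N: "H \<lhd> K" by (rule K.subgroup_imp_normal[OF sH])
      have Q: "group (K Mod H)" by (rule normal.factorgroup_is_group[OF N])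
      let ?C = "H #>\<^bsub>K\<^esub> x"
      have C: "?C \<in> carrier (K Mod H)" unfolding carrier_FactGroup using x by blast
      have "?C [^]\<^bsub>K Mod H\<^esub> K.ord x = H #>\<^bsub>K\<^esub> (x [^]\<^bsub>K\<^esub> K.ord x)"
        by (rule normal.FactGroup_pow[OF N]) (use x in blast)
      also have "\<dots> = \<one>\<^bsub>K Mod H\<^esub>"
        unfolding one_FactGroup using x K.coset_mult_one[OF subgroup.subset[OF sH]] K.pow_ord_eq_1[of x] by auto
      finally have "group.ord (K Mod H) ?C dvd K.ord x" using group.pow_eq_id[OF Q C] by blast
      then have odd: "odd (group.ord (K Mod H) ?C)" using x by (auto elim: dvd_trans)
      have "group.ord (K Mod H) ?C dvd card (rcosets\<^bsub>K\<^esub> H)"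
        using group.ord_dvd_group_order[OF Q C] by (simp add: order_def FactGroup_def)
      then have "r = 2" if "prime r" "r dvd group.ord (K Mod H) ?C" for r
        using H that unfolding hall_subgroup_def by (blast dest: dvd_trans)
      then have "group.ord (K Mod H) ?C = 1" using odd prime_factor_nat[of "group.ord (K Mod H) ?C"] by blast
      then have "?C = H" using group.ord_eq_1[OF Q C] one_FactGroup by metis
      then show "x \<in> H" using K.rcos_self[OF _ sH, of x] x by blast
    qed
  qed
  show "hall_odd K = ?O"
    unfolding hall_odd_def using ex uniq by (rule the_equality)
  show "hall_subgroup {r. prime r \<and> r \<noteq> 2} H K \<longleftrightarrow> H = ?O"
    using ex uniq by blast
qed

end

theory Submission
  imports Defs
begin

text \<open>Since \<open>q\<close> divides \<open>\<bar>F\<^sup>\<times>\<bar>\<close>, there is a primitive \<open>q\<close>-th root of unity \<open>w\<close> in \<open>F\<close>, and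
  \<open>\<chi> (b\<^sup>i) (b\<^sup>j) = w\<^sup>i\<^sup>j\<close> is a nondegenerate symmetric pairing of \<open>B\<close> with itself. The Fourier transform
  along \<open>\<chi>\<close> applied twice is \<open>q\<close> times \<open>*\<close>, so it is bijective; it identifies \<open>FB\<close> with the algebra of
  functions \<open>h\<close> from \<open>B\<close> to \<open>F\<close> under pointwise multiplication, turns \<open>*\<close> into \<open>h \<mapsto> h \<circ> inv\<close> and the
  augmentation into \<open>h \<mapsto> h 1\<close>. A symmetric or unitary unit is then an arbitrary choice of nonzero
  values on one element of each of the \<open>(q - 1) / 2\<close> pairs \<open>{x, x\<^sup>-\<^sup>1}\<close>. For the odd parts, an element \<open>x\<close>
  of odd order has a square root \<open>r\<close> of odd order, and \<open>x = (r r\<^sup>*) (r (r\<^sup>*)\<^sup>-\<^sup>1)\<close>.\<close>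

section \<open>Rearranging finite sums\<close>

lemma (in abelian_monoid) finsum_swap:
  assumes "finite A" "finite C"
    and "\<And>x y. x \<in> A \<Longrightarrow> y \<in> C \<Longrightarrow> f x y \<in> carrier G"
  shows "(\<Oplus>x\<in>A. \<Oplus>y\<in>C. f x y) = (\<Oplus>y\<in>C. \<Oplus>x\<in>A. f x y)"
  using assms(1,3)
proof (induction A rule: finite_induct)
  case empty
  then show ?case by (simp add: finsum_zero)
next
  case (insert a A)
  have "(\<Oplus>x\<in>insert a A. \<Oplus>y\<in>C. f x y) = (\<Oplus>y\<in>C. f a y) \<oplus> (\<Oplus>y\<in>C. \<Oplus>x\<in>A. f x y)"
    using insert by (simp add: finsum_closed Pi_def)
  also have "\<dots> = (\<Oplus>y\<in>C. f a y \<oplus> (\<Oplus>x\<in>A. f x y))"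
    using insert by (intro finsum_addf[symmetric]) (auto intro!: finsum_closed)
  also have "\<dots> = (\<Oplus>y\<in>C. \<Oplus>x\<in>insert a A. f x y)"
    using insert by (intro finsum_cong') (auto intro!: finsum_closed)
  finally show ?case .
qed

lemma (in group) bij_betw_translation:
  assumes "a \<in> carrier G"
  shows "bij_betw (\<lambda>x. a \<otimes> x) (carrier G) (carrier G)"
  by (rule bij_betw_byWitness[where f' = "\<lambda>x. inv a \<otimes> x"])
    (use assms in \<open>auto simp: m_assoc[symmetric]\<close>)

lemma (in abelian_monoid) finsum_translate:
  assumes "group B" "a \<in> carrier B" "f \<in> carrier B \<rightarrow> carrier G"
  shows "(\<Oplus>x\<in>carrier B. f (a \<otimes>\<^bsub>B\<^esub> x)) = (\<Oplus>x\<in>carrier B. f x)"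
  using finsum_reindex[of f "\<lambda>x. a \<otimes>\<^bsub>B\<^esub> x" "carrier B"] assms(3)
    group.bij_betw_translation[OF assms(1,2)] by (simp add: bij_betw_def)


section \<open>The Fourier transform on a group algebra\<close>

text \<open>The setting in which a finite abelian group serves as its own dual over
  \<open>R\<close>. Multiplicativity is asked in the first argument only, since symmetry carries it
  to the second. Nondegeneracy gives orthogonality of characters, \<open>order_nonzero\<close> gives
  injectivity of the transform, and finiteness of \<open>R\<close> then gives surjectivity.\<close>

locale group_pairing = field R + B: comm_group B
  for R (structure) and B (structure) +
  fixes \<chi> :: "'c \<Rightarrow> 'c \<Rightarrow> 'a"
  assumes finite_R: "finite (carrier R)"
    and finite_B: "finite (carrier B)"
    and \<chi>_closed [simp, intro]: "\<lbrakk>x \<in> carrier B; y \<in> carrier B\<rbrakk> \<Longrightarrow> \<chi> x y \<in> carrier R"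
    and \<chi>_mult: "\<lbrakk>x \<in> carrier B; y \<in> carrier B; z \<in> carrier B\<rbrakk> \<Longrightarrow>
      \<chi> (x \<otimes>\<^bsub>B\<^esub> y) z = \<chi> x z \<otimes> \<chi> y z"
    and \<chi>_one: "y \<in> carrier B \<Longrightarrow> \<chi> \<one>\<^bsub>B\<^esub> y = \<one>"
    and \<chi>_sym: "\<lbrakk>x \<in> carrier B; y \<in> carrier B\<rbrakk> \<Longrightarrow> \<chi> x y = \<chi> y x"
    and \<chi>_nondegenerate: "\<lbrakk>y \<in> carrier B; y \<noteq> \<one>\<^bsub>B\<^esub>\<rbrakk> \<Longrightarrow> \<exists>x\<in>carrier B. \<chi> x y \<noteq> \<one>"
    and order_nonzero: "[order B] \<cdot> \<one> \<noteq> \<zero>"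
begin

abbreviation "A \<equiv> group_algebra R B"

text \<open>The pairing indexes the characters of \<open>B\<close> by the elements of
  \<open>B\<close>, so the transform is a function on \<open>B\<close> again and can be
  iterated.\<close>

definition fourier :: "('c \<Rightarrow> 'a) \<Rightarrow> 'c \<Rightarrow> 'a" where
  "fourier u = (\<lambda>y\<in>carrier B. \<Oplus>x\<in>carrier B. u x \<otimes> \<chi> x y)"

lemma carrier_A: "carrier A = carrier B \<rightarrow>\<^sub>E carrier R"
  using finite_B by (auto simp: group_algebra_def)

lemma A_closed: "u \<in> carrier A \<Longrightarrow> x \<in> carrier B \<Longrightarrow> u x \<in> carrier R"
  by (auto simp: carrier_A)

lemma A_ext: "u \<in> carrier A \<Longrightarrow> v \<in> carrier A \<Longrightarrow> (\<And>x. x \<in> carrier B \<Longrightarrow> u x = v x) \<Longrightarrow> u = v"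
  unfolding carrier_A by (rule PiE_ext)

text \<open>The product of \<open>group_algebra\<close> sums over the support of the left factor. As
  \<open>B\<close> is finite, the sum may run over all of \<open>B\<close>, because the added terms
  vanish.\<close>

lemma mult_A:
  assumes "u \<in> carrier A" "v \<in> carrier A"
  shows "u \<otimes>\<^bsub>A\<^esub> v = (\<lambda>x\<in>carrier B. \<Oplus>y\<in>carrier B. u y \<otimes> v (inv\<^bsub>B\<^esub> y \<otimes>\<^bsub>B\<^esub> x))"
  unfolding group_algebra_def monoid.simps
  by (intro restrict_ext add.finprod_mono_neutral_cong_left)
    (use finite_B A_closed[OF assms(1)] A_closed[OF assms(2)] in \<open>auto\<close>)

lemma mult_A_closed: "u \<in> carrier A \<Longrightarrow> v \<in> carrier A \<Longrightarrow> u \<otimes>\<^bsub>A\<^esub> v \<in> carrier A"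
  by (subst mult_A) (auto simp: carrier_A intro!: finsum_closed)

lemma one_A: "\<one>\<^bsub>A\<^esub> = (\<lambda>x\<in>carrier B. if x = \<one>\<^bsub>B\<^esub> then \<one> else \<zero>)"
  by (simp add: group_algebra_def)

lemma one_A_closed: "\<one>\<^bsub>A\<^esub> \<in> carrier A"
  by (auto simp: one_A carrier_A)

lemma star_closed: "u \<in> carrier A \<Longrightarrow> star B u \<in> carrier A"
  by (auto simp: star_def carrier_A)

lemma star_star: "u \<in> carrier A \<Longrightarrow> star B (star B u) = u"
  by (rule A_ext) (simp_all add: star_closed, simp add: star_def)

lemma fourier_closed: "u \<in> carrier A \<Longrightarrow> fourier u \<in> carrier A"
  by (auto simp: fourier_def carrier_A intro!: finsum_closed)

text \<open>After exchanging the sums, the substitution of \<open>y\<close> times \<open>x\<close>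
  for \<open>x\<close> turns the convolution into a double sum whose terms separate, because
  \<open>\<chi>\<close> is multiplicative.\<close>

lemma fourier_mult:
  assumes u: "u \<in> carrier A" and v: "v \<in> carrier A" and z: "z \<in> carrier B"
  shows "fourier (u \<otimes>\<^bsub>A\<^esub> v) z = fourier u z \<otimes> fourier v z"
proof -
  note [simp] = A_closed[OF u] A_closed[OF v] z finite_B
  have "fourier (u \<otimes>\<^bsub>A\<^esub> v) z
      = (\<Oplus>x\<in>carrier B. \<Oplus>y\<in>carrier B. u y \<otimes> v (inv\<^bsub>B\<^esub> y \<otimes>\<^bsub>B\<^esub> x) \<otimes> \<chi> x z)"
    by (auto simp: fourier_def mult_A u v Pi_def finsum_ldistr intro!: finsum_cong' finsum_closed)
  also have "\<dots> = (\<Oplus>y\<in>carrier B. \<Oplus>x\<in>carrier B. u y \<otimes> v (inv\<^bsub>B\<^esub> y \<otimes>\<^bsub>B\<^esub> x) \<otimes> \<chi> x z)"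
    by (rule finsum_swap) auto
  also have "\<dots> = (\<Oplus>y\<in>carrier B. \<Oplus>x\<in>carrier B. u y \<otimes> \<chi> y z \<otimes> (v x \<otimes> \<chi> x z))"
  proof (rule finsum_cong')
    fix y assume y: "y \<in> carrier B"
    have "(\<Oplus>x\<in>carrier B. u y \<otimes> v (inv\<^bsub>B\<^esub> y \<otimes>\<^bsub>B\<^esub> x) \<otimes> \<chi> x z)
      = (\<Oplus>x\<in>carrier B. u y \<otimes> v (inv\<^bsub>B\<^esub> y \<otimes>\<^bsub>B\<^esub> (y \<otimes>\<^bsub>B\<^esub> x)) \<otimes> \<chi> (y \<otimes>\<^bsub>B\<^esub> x) z)"
      by (rule finsum_translate[OF B.group_axioms y, symmetric]) (use y in auto)
    also have "\<dots> = (\<Oplus>x\<in>carrier B. u y \<otimes> \<chi> y z \<otimes> (v x \<otimes> \<chi> x z))"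
      using y by (intro finsum_cong') (auto simp: B.m_assoc[symmetric] \<chi>_mult m_ac)
    finally show "(\<Oplus>x\<in>carrier B. u y \<otimes> v (inv\<^bsub>B\<^esub> y \<otimes>\<^bsub>B\<^esub> x) \<otimes> \<chi> x z)
      = (\<Oplus>x\<in>carrier B. u y \<otimes> \<chi> y z \<otimes> (v x \<otimes> \<chi> x z))" .
  qed (auto intro!: finsum_closed)
  also have "\<dots> = (\<Oplus>y\<in>carrier B. u y \<otimes> \<chi> y z \<otimes> fourier v z)"
    by (intro finsum_cong') (auto simp: fourier_def finsum_rdistr Pi_def intro!: finsum_closed)
  also have "\<dots> = fourier u z \<otimes> fourier v z"
    using A_closed[OF fourier_closed[OF v] z] by (subst finsum_ldistr[symmetric]) (auto simp: fourier_def)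
  finally show ?thesis .
qed

lemma fourier_one: "y \<in> carrier B \<Longrightarrow> fourier \<one>\<^bsub>A\<^esub> y = \<one>"
proof -
  assume y: "y \<in> carrier B"
  have "fourier \<one>\<^bsub>A\<^esub> y = (\<Oplus>x\<in>carrier B. if \<one>\<^bsub>B\<^esub> = x then \<chi> x y else \<zero>)"
    using y by (auto simp: fourier_def one_A intro!: finsum_cong')
  then show ?thesis using finsum_singleton[of "\<one>\<^bsub>B\<^esub>" "carrier B" "\<lambda>x. \<chi> x y"] y finite_B \<chi>_one by auto
qed

lemma fourier_star:
  assumes u: "u \<in> carrier A" and y: "y \<in> carrier B"
  shows "fourier (star B u) y = fourier u (inv\<^bsub>B\<^esub> y)"
proof -
  \<comment> \<open>Both sides are inverse to \<open>\<chi> x y\<close>, so they agree by uniqueness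
    of inverses.\<close>
  have \<chi>_inv: "\<chi> (inv\<^bsub>B\<^esub> x) y = \<chi> x (inv\<^bsub>B\<^esub> y)" if x: "x \<in> carrier B" for x
  proof -
    have "\<chi> x y \<otimes> \<chi> x (inv\<^bsub>B\<^esub> y) = \<one>"
      using x y \<chi>_mult[of y "inv\<^bsub>B\<^esub> y" x] \<chi>_one[of x]
      by (simp add: \<chi>_sym[of x y] \<chi>_sym[of x "inv\<^bsub>B\<^esub> y"])
    moreover have "\<chi> (inv\<^bsub>B\<^esub> x) y \<otimes> \<chi> x y = \<one>"
      using x y \<chi>_mult[of "inv\<^bsub>B\<^esub> x" x y] \<chi>_one[of y] by simp
    ultimately show ?thesis
      using x y inv_unique[of "\<chi> (inv\<^bsub>B\<^esub> x) y" "\<chi> x y" "\<chi> x (inv\<^bsub>B\<^esub> y)"] by simp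
  qed
  have \<chi>_inv_inv: "\<chi> (inv\<^bsub>B\<^esub> x) (inv\<^bsub>B\<^esub> y) = \<chi> x y" if x: "x \<in> carrier B" for x
    using \<chi>_inv[of "inv\<^bsub>B\<^esub> x"] x by simp
  have inj: "inj_on (\<lambda>x. inv\<^bsub>B\<^esub> x) (carrier B)" by (rule B.inv_inj)
  have im: "(\<lambda>x. inv\<^bsub>B\<^esub> x) ` carrier B = carrier B"
    using endo_inj_surj[OF finite_B _ inj] by auto
  have "fourier u (inv\<^bsub>B\<^esub> y) = (\<Oplus>x\<in>carrier B. u (inv\<^bsub>B\<^esub> x) \<otimes> \<chi> (inv\<^bsub>B\<^esub> x) (inv\<^bsub>B\<^esub> y))"
    using finsum_reindex[OF _ inj, of "\<lambda>x. u x \<otimes> \<chi> x (inv\<^bsub>B\<^esub> y)"] y A_closed[OF u]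
    by (auto simp: im fourier_def)
  also have "\<dots> = fourier (star B u) y"
    using y A_closed[OF u] \<chi>_inv_inv by (auto simp: fourier_def star_def intro!: finsum_cong')
  finally show ?thesis ..
qed

lemma augmentation_eq_fourier: "u \<in> carrier A \<Longrightarrow> augmentation R B u = fourier u \<one>\<^bsub>B\<^esub>"
  unfolding augmentation_def fourier_def
  using finite_B by (auto simp: A_closed \<chi>_sym[of _ "\<one>\<^bsub>B\<^esub>"] \<chi>_one intro!: add.finprod_mono_neutral_cong_left)

text \<open>Orthogonality of characters: translating by some \<open>a\<close> with
  \<open>\<chi> a y\<close> different from 1 leaves the sum \<open>S\<close> unchanged but also
  multiplies it by \<open>\<chi> a y\<close>.\<close>

lemma sum_\<chi>:
  assumes y: "y \<in> carrier B" "y \<noteq> \<one>\<^bsub>B\<^esub>"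
  shows "(\<Oplus>x\<in>carrier B. \<chi> x y) = \<zero>"
proof -
  define S where "S = (\<Oplus>x\<in>carrier B. \<chi> x y)"
  have S: "S \<in> carrier R" using y unfolding S_def by (auto intro: finsum_closed)
  obtain a where a: "a \<in> carrier B" "\<chi> a y \<noteq> \<one>" using \<chi>_nondegenerate[OF y] by blast
  have "S = (\<Oplus>x\<in>carrier B. \<chi> (a \<otimes>\<^bsub>B\<^esub> x) y)"
    unfolding S_def by (rule finsum_translate[OF B.group_axioms a(1), symmetric]) (use y in auto)
  also have "\<dots> = \<chi> a y \<otimes> S"
    unfolding S_def using a y finite_B
    by (subst finsum_rdistr) (auto simp: \<chi>_mult intro!: finsum_cong')
  finally have "\<chi> a y \<otimes> S = \<one> \<otimes> S" using S by simp
  then have "S = \<zero>" using m_rcancel[of S "\<chi> a y" \<one>] S a y by auto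
  then show ?thesis unfolding S_def .
qed

text \<open>Exchanging the sums leaves an inner character sum at the product of \<open>x\<close> and
  \<open>z\<close>. By orthogonality only the inverse of \<open>z\<close> contributes, with weight
  the order of \<open>B\<close>.\<close>

lemma fourier_fourier:
  assumes u: "u \<in> carrier A" and z: "z \<in> carrier B"
  shows "fourier (fourier u) z = u (inv\<^bsub>B\<^esub> z) \<otimes> [order B] \<cdot> \<one>"
proof -
  note [simp] = A_closed[OF u] z finite_B
  have "fourier (fourier u) z = (\<Oplus>y\<in>carrier B. \<Oplus>x\<in>carrier B. u x \<otimes> \<chi> x y \<otimes> \<chi> y z)"
    by (auto simp: fourier_def finsum_ldistr intro!: finsum_cong' finsum_closed)
  also have "\<dots> = (\<Oplus>x\<in>carrier B. \<Oplus>y\<in>carrier B. u x \<otimes> \<chi> x y \<otimes> \<chi> y z)"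
    by (rule finsum_swap) auto
  also have "\<dots> = (\<Oplus>x\<in>carrier B. if inv\<^bsub>B\<^esub> z = x then u x \<otimes> [order B] \<cdot> \<one> else \<zero>)"
  proof (rule finsum_cong')
    fix x assume x: "x \<in> carrier B"
    have "(\<Oplus>y\<in>carrier B. u x \<otimes> \<chi> x y \<otimes> \<chi> y z) = (\<Oplus>y\<in>carrier B. u x \<otimes> \<chi> y (x \<otimes>\<^bsub>B\<^esub> z))"
      using x by (auto simp: \<chi>_sym[of _ z] \<chi>_sym[of _ "x \<otimes>\<^bsub>B\<^esub> z"] \<chi>_mult m_assoc intro!: finsum_cong')
    also have "\<dots> = u x \<otimes> (\<Oplus>y\<in>carrier B. \<chi> y (x \<otimes>\<^bsub>B\<^esub> z))"
      using x by (subst finsum_rdistr) auto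
    also have "(\<Oplus>y\<in>carrier B. \<chi> y (x \<otimes>\<^bsub>B\<^esub> z)) = (if inv\<^bsub>B\<^esub> z = x then [order B] \<cdot> \<one> else \<zero>)"
    proof (cases "inv\<^bsub>B\<^esub> z = x")
      case True
      then have "x \<otimes>\<^bsub>B\<^esub> z = \<one>\<^bsub>B\<^esub>" by auto
      then have "(\<Oplus>y\<in>carrier B. \<chi> y (x \<otimes>\<^bsub>B\<^esub> z)) = (\<Oplus>y\<in>carrier B. \<one>)"
        by (auto simp: \<chi>_sym[of _ "\<one>\<^bsub>B\<^esub>"] \<chi>_one intro!: finsum_cong')
      then show ?thesis using True add.finprod_const[of \<one> "carrier B"] by (simp add: order_def)
    next
      case False
      then have "x \<otimes>\<^bsub>B\<^esub> z \<noteq> \<one>\<^bsub>B\<^esub>" using x B.inv_equality by auto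
      then show ?thesis using False sum_\<chi> x by simp
    qed
    finally show "(\<Oplus>y\<in>carrier B. u x \<otimes> \<chi> x y \<otimes> \<chi> y z)
        = (if inv\<^bsub>B\<^esub> z = x then u x \<otimes> [order B] \<cdot> \<one> else \<zero>)"
      using x by simp
  qed auto
  also have "\<dots> = u (inv\<^bsub>B\<^esub> z) \<otimes> [order B] \<cdot> \<one>"
    using finsum_singleton[of "inv\<^bsub>B\<^esub> z" "carrier B" "\<lambda>x. u x \<otimes> [order B] \<cdot> \<one>"] by auto
  finally show ?thesis .
qed

lemma inj_fourier: "inj_on fourier (carrier A)"
proof (rule inj_onI)
  fix u v assume u: "u \<in> carrier A" and v: "v \<in> carrier A" and eq: "fourier u = fourier v"
  show "u = v"
  proof (rule A_ext[OF u v])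
    fix x assume x: "x \<in> carrier B"
    have "u x \<otimes> [order B] \<cdot> \<one> = v x \<otimes> [order B] \<cdot> \<one>"
      using fourier_fourier[OF u, of "inv\<^bsub>B\<^esub> x"] fourier_fourier[OF v, of "inv\<^bsub>B\<^esub> x"] eq x by simp
    then show "u x = v x"
      using m_rcancel[of "[order B] \<cdot> \<one>" "u x" "v x"] order_nonzero A_closed u v x by auto
  qed
qed

lemma fourier_eqD:
  assumes "u \<in> carrier A" "v \<in> carrier A" "\<And>y. y \<in> carrier B \<Longrightarrow> fourier u y = fourier v y"
  shows "u = v"
  using inj_onD[OF inj_fourier _ assms(1,2)] A_ext[OF assms(1,2)[THEN fourier_closed] assms(3)] by blast

text \<open>Convolution becomes pointwise multiplication under the injective map \<open>fourier\<close>, so the monoid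
  laws need no computation with convolutions.\<close>

lemma comm_monoid_A: "comm_monoid A"
  by unfold_locales
    (auto intro!: mult_A_closed one_A_closed fourier_eqD
      simp: fourier_mult fourier_one mult_A_closed one_A_closed m_ac A_closed fourier_closed)

text \<open>An injective map of a finite set to itself is surjective, so no inversion formula has to
  be written down.\<close>

lemma bij_betw_fourier: "bij_betw fourier (carrier A) (carrier A)"
proof -
  have "finite (carrier A)" using finite_B finite_R by (auto simp: carrier_A intro: finite_PiE)
  then show ?thesis using endo_inj_surj[OF _ _ inj_fourier] inj_fourier fourier_closed
    by (auto simp: bij_betw_def)
qed

section \<open>Units described by the values of their transforms\<close>

lemma Units_A: "Units A = {u \<in> carrier A. \<forall>y\<in>carrier B. fourier u y \<noteq> \<zero>}"
proof (intro subset_antisym subsetI)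
  fix u assume "u \<in> Units A"
  then obtain v where uv: "u \<in> carrier A" "v \<in> carrier A" "u \<otimes>\<^bsub>A\<^esub> v = \<one>\<^bsub>A\<^esub>"
    unfolding Units_def by blast
  then have "fourier u y \<otimes> fourier v y = \<one>" if "y \<in> carrier B" for y
    using fourier_mult[OF uv(1,2) that] fourier_one[OF that] by simp
  then show "u \<in> {u \<in> carrier A. \<forall>y\<in>carrier B. fourier u y \<noteq> \<zero>}"
    using uv(1) A_closed[OF fourier_closed[OF uv(2)]] by fastforce
next
  fix u assume "u \<in> {u \<in> carrier A. \<forall>y\<in>carrier B. fourier u y \<noteq> \<zero>}"
  then have u: "u \<in> carrier A" "\<And>y. y \<in> carrier B \<Longrightarrow> fourier u y \<in> Units R"
    using fourier_closed A_closed by (auto simp: field_Units)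
  define h where "h = (\<lambda>y\<in>carrier B. inv (fourier u y))"
  have "h \<in> carrier A" using u by (auto simp: h_def carrier_A)
  then obtain v where v: "v \<in> carrier A" "fourier v = h"
    using bij_betw_fourier by (metis bij_betw_def imageE)
  have "u \<otimes>\<^bsub>A\<^esub> v = \<one>\<^bsub>A\<^esub>" "v \<otimes>\<^bsub>A\<^esub> u = \<one>\<^bsub>A\<^esub>"
    using u v by (auto intro!: fourier_eqD mult_A_closed one_A_closed simp: fourier_mult fourier_one h_def)
  then show "u \<in> Units A" using u v unfolding Units_def by blast
qed

lemma carrier_normalized_units:
  "carrier (normalized_units R B) =
    {u \<in> carrier A. (\<forall>y\<in>carrier B. fourier u y \<noteq> \<zero>) \<and> fourier u \<one>\<^bsub>B\<^esub> = \<one>}"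
  by (auto simp: normalized_units_def Units_A augmentation_eq_fourier)

lemma normalized_units_simps [simp]:
  "monoid.mult (normalized_units R B) = monoid.mult A"
  "monoid.one (normalized_units R B) = monoid.one A"
  by (simp_all add: normalized_units_def units_of_def)

lemma finite_normalized_units: "finite (carrier (normalized_units R B))"
proof (rule finite_subset)
  show "carrier (normalized_units R B) \<subseteq> carrier A" by (auto simp: carrier_normalized_units)
qed (use finite_B finite_R in \<open>auto simp: carrier_A intro: finite_PiE\<close>)

lemma comm_group_normalized_units: "comm_group (normalized_units R B)"
proof (rule comm_groupI)
  fix u assume u: "u \<in> carrier (normalized_units R B)"
  then have "u \<in> Units A" by (auto simp: normalized_units_def)
  then obtain v where v: "v \<in> Units A" "v \<otimes>\<^bsub>A\<^esub> u = \<one>\<^bsub>A\<^esub>"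
    using monoid.Units_inv_Units monoid.Units_l_inv comm_monoid.axioms(1)[OF comm_monoid_A] by metis
  \<comment> \<open>At the identity of \<open>B\<close> the transform is the augmentation, so the
    inverse of a unit of augmentation 1 again has augmentation 1.\<close>
  then have "fourier v \<one>\<^bsub>B\<^esub> \<otimes> fourier u \<one>\<^bsub>B\<^esub> = \<one>"
    using fourier_mult[of v u "\<one>\<^bsub>B\<^esub>"] fourier_one u by (auto simp: carrier_normalized_units Units_A)
  then have "fourier v \<one>\<^bsub>B\<^esub> = \<one>"
    using u v A_closed[OF fourier_closed[of v]] by (auto simp: carrier_normalized_units Units_A)
  then show "\<exists>v\<in>carrier (normalized_units R B).
      v \<otimes>\<^bsub>normalized_units R B\<^esub> u = \<one>\<^bsub>normalized_units R B\<^esub>"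
    using v by (auto simp: carrier_normalized_units Units_A)
qed (use comm_monoid_A fourier_closed A_closed in
    \<open>auto simp: carrier_normalized_units mult_A_closed one_A_closed fourier_mult fourier_one integral_iff
      intro: comm_monoid.m_comm monoid.m_assoc monoid.l_one comm_monoid.axioms(1)\<close>)

text \<open>On transforms \<open>star B\<close> is composition with inversion, which respects
  pointwise products.\<close>

lemma star_hom: "star B \<in> hom (normalized_units R B) (normalized_units R B)"
proof (rule homI)
  fix u v assume "u \<in> carrier (normalized_units R B)" "v \<in> carrier (normalized_units R B)"
  then show "star B (u \<otimes>\<^bsub>normalized_units R B\<^esub> v) = star B u \<otimes>\<^bsub>normalized_units R B\<^esub> star B v"
    by (intro fourier_eqD)
      (auto simp: carrier_normalized_units mult_A_closed star_closed fourier_star fourier_mult)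
qed (auto simp: carrier_normalized_units star_closed fourier_star)

lemma symmetric_units_iff:
  "u \<in> carrier (symmetric_units R B) \<longleftrightarrow> u \<in> carrier (normalized_units R B) \<and>
    (\<forall>y\<in>carrier B. fourier u (inv\<^bsub>B\<^esub> y) = fourier u y)"
proof -
  have "star B u = u \<longleftrightarrow> (\<forall>y\<in>carrier B. fourier u (inv\<^bsub>B\<^esub> y) = fourier u y)" if "u \<in> carrier A"
    using that fourier_eqD[of "star B u" u] by (auto simp: fourier_star[symmetric] star_closed)
  then show ?thesis by (auto simp: symmetric_units_def carrier_normalized_units)
qed

lemma unitary_units_iff:
  "u \<in> carrier (unitary_units R B) \<longleftrightarrow> u \<in> carrier (normalized_units R B) \<and>
    (\<forall>y\<in>carrier B. fourier u (inv\<^bsub>B\<^esub> y) = inv (fourier u y))"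
proof -
  interpret V: comm_group "normalized_units R B" by (rule comm_group_normalized_units)
  have "star B u = inv\<^bsub>normalized_units R B\<^esub> u \<longleftrightarrow>
      (\<forall>y\<in>carrier B. fourier u (inv\<^bsub>B\<^esub> y) = inv (fourier u y))"
    if u: "u \<in> carrier (normalized_units R B)"
  proof -
    have s: "star B u \<in> carrier (normalized_units R B)" using hom_in_carrier[OF star_hom u] .
    have uA: "u \<in> carrier A" and unit: "\<And>y. y \<in> carrier B \<Longrightarrow> fourier u y \<in> Units R"
      using u fourier_closed A_closed by (auto simp: carrier_normalized_units field_Units)
    \<comment> \<open>The inverse taken in the group of normalized units is traded for a product
      equation in \<open>A\<close>, which the transform can read pointwise.\<close>
    have "star B u = inv\<^bsub>normalized_units R B\<^esub> u \<longleftrightarrow> star B u \<otimes>\<^bsub>A\<^esub> u = \<one>\<^bsub>A\<^esub>"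
      using V.inv_equality[of "star B u" u] V.l_inv[OF u] u s unfolding normalized_units_simps by metis
    also have "\<dots> \<longleftrightarrow> (\<forall>y\<in>carrier B. fourier (star B u \<otimes>\<^bsub>A\<^esub> u) y = fourier \<one>\<^bsub>A\<^esub> y)"
      using fourier_eqD[of "star B u \<otimes>\<^bsub>A\<^esub> u" "\<one>\<^bsub>A\<^esub>"] uA
      by (auto simp: mult_A_closed star_closed one_A_closed)
    also have "\<dots> \<longleftrightarrow> (\<forall>y\<in>carrier B. fourier u (inv\<^bsub>B\<^esub> y) \<otimes> fourier u y = \<one>)"
      using uA by (auto simp: fourier_mult fourier_one star_closed fourier_star)
    also have "\<dots> \<longleftrightarrow> (\<forall>y\<in>carrier B. fourier u (inv\<^bsub>B\<^esub> y) = inv (fourier u y))"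
    proof (rule ball_cong[OF refl])
      fix y assume y: "y \<in> carrier B"
      have c: "fourier u y \<in> carrier R" "fourier u (inv\<^bsub>B\<^esub> y) \<in> carrier R"
        using y uA fourier_closed A_closed by auto
      show "fourier u (inv\<^bsub>B\<^esub> y) \<otimes> fourier u y = \<one> \<longleftrightarrow> fourier u (inv\<^bsub>B\<^esub> y) = inv (fourier u y)"
        using inv_unique'[of "fourier u (inv\<^bsub>B\<^esub> y)" "fourier u y"] Units_l_inv[OF unit[OF y]] c
          m_comm[OF c] comm_inv_char[OF c] by metis
    qed
    finally show ?thesis .
  qed
  then show ?thesis by (auto simp: unitary_units_def)
qed

end


section \<open>Counting equivariant functions\<close>

lemma (in group) eq_one_if_odd_ord_self_inverse:
  assumes x: "x \<in> carrier G" "inv x = x" "odd (ord x)"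
  shows "x = \<one>"
proof -
  have "x [^] (2::nat) = \<one>" using x r_inv[of x] by (simp add: numeral_2_eq_2)
  then have "ord x dvd 2" using pow_eq_id x(1) by blast
  then have "ord x \<le> 2" by (rule dvd_imp_le) simp
  \<comment> \<open>The value 0 stands for infinite order. It is even, so oddness of the order
    excludes it along with 2.\<close>
  then have "ord x = 0 \<or> ord x = 1 \<or> ord x = 2" by linarith
  then have "ord x = 1" using x(3) by auto
  then show ?thesis using ord_eq_1 x(1) by blast
qed

lemma (in group) half_system:
  assumes fin: "finite (carrier G)" and odd: "odd (order G)"
  obtains P where "P \<subseteq> carrier G" "\<one> \<notin> P" "card P = (order G - 1) div 2"
    "\<And>x. \<lbrakk>x \<in> carrier G; x \<noteq> \<one>\<rbrakk> \<Longrightarrow> inv x \<in> P \<longleftrightarrow> x \<notin> P"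
proof -
  obtain f :: "'a \<Rightarrow> nat" where f: "inj_on f (carrier G)"
    using finite_imp_inj_to_nat_seg[OF fin] by blast
  \<comment> \<open>An arbitrary numbering breaks the tie inside each pair of mutually inverse
    elements. The strict inequality keeps the identity out.\<close>
  define P where "P = {x \<in> carrier G. f x < f (inv x)}"
  have ne: "inv x \<noteq> x" if "x \<in> carrier G" "x \<noteq> \<one>" for x
    using that eq_one_if_odd_ord_self_inverse ord_dvd_group_order[OF that(1)] odd dvd_trans by blast
  have P: "inv x \<in> P \<longleftrightarrow> x \<notin> P" if "x \<in> carrier G" "x \<noteq> \<one>" for x
  proof -
    have "f (inv x) \<noteq> f x" using that ne[OF that] inj_onD[OF f, of "inv x" x] by auto
    then show ?thesis using that by (auto simp: P_def)
  qed
  have one: "\<one> \<notin> P" and sub: "P \<subseteq> carrier G" by (auto simp: P_def)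
  have un: "carrier G - {\<one>} = P \<union> (\<lambda>x. inv x) ` P"
  proof (intro subset_antisym subsetI)
    fix x assume x: "x \<in> carrier G - {\<one>}"
    then have "x \<in> P \<or> inv x \<in> P" using P by blast
    then show "x \<in> P \<union> (\<lambda>x. inv x) ` P" using x by (metis DiffD1 UnI1 UnI2 image_eqI inv_inv)
  qed (use sub one in auto)
  have disj: "P \<inter> (\<lambda>x. inv x) ` P = {}" using P sub one by blast
  have "card (carrier G - {\<one>}) = card P + card ((\<lambda>x. inv x) ` P)"
    unfolding un using fin sub disj by (intro card_Un_disjoint) (auto intro: finite_subset)
  also have "card ((\<lambda>x. inv x) ` P) = card P"
    using inj_on_subset[OF inv_inj sub] by (rule card_image)
  finally have "card P = (order G - 1) div 2" using fin by (simp add: order_def)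
  then show thesis using that sub one P by blast
qed

text \<open>The involution \<open>\<sigma>\<close> is kept general so that the identity map serves
  the symmetric units and inversion the unitary ones. Such an \<open>h\<close> is determined by its
  restriction to a half system, and that restriction is arbitrary.\<close>

lemma (in group) card_inv_equivariant:
  assumes fin: "finite (carrier G)" and odd: "odd (order G)"
    and \<sigma>: "\<And>s. s \<in> S \<Longrightarrow> \<sigma> s \<in> S" "\<And>s. s \<in> S \<Longrightarrow> \<sigma> (\<sigma> s) = s" and e: "e \<in> S" "\<sigma> e = e"
  shows "card {h \<in> carrier G \<rightarrow>\<^sub>E S. h \<one> = e \<and> (\<forall>x\<in>carrier G. h (inv x) = \<sigma> (h x))}
    = card S ^ ((order G - 1) div 2)"
proof -
  obtain P where P: "P \<subseteq> carrier G" "\<one> \<notin> P" "card P = (order G - 1) div 2"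
    "\<And>x. \<lbrakk>x \<in> carrier G; x \<noteq> \<one>\<rbrakk> \<Longrightarrow> inv x \<in> P \<longleftrightarrow> x \<notin> P"
    using half_system[OF fin odd] by blast
  \<comment> \<open>The only possible equivariant extension: outside the half system, values are
    forced by those at the inverses.\<close>
  define ext where "ext k = (\<lambda>x\<in>carrier G. if x = \<one> then e else if x \<in> P then k x else \<sigma> (k (inv x)))"
    for k :: "'a \<Rightarrow> 'c"
  let ?X = "{h \<in> carrier G \<rightarrow>\<^sub>E S. h \<one> = e \<and> (\<forall>x\<in>carrier G. h (inv x) = \<sigma> (h x))}"
  have "bij_betw (\<lambda>h. restrict h P) ?X (P \<rightarrow>\<^sub>E S)"
  proof (rule bij_betw_byWitness[where f' = ext])
    show "\<forall>h\<in>?X. ext (restrict h P) = h"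
    proof
      fix h assume h: "h \<in> ?X"
      show "ext (restrict h P) = h"
      proof
        fix x
        show "ext (restrict h P) x = h x"
          using h P(4)[of x] \<sigma>(2)[of "h x"] by (cases "x \<in> carrier G") (auto simp: ext_def)
      qed
    qed
    show "\<forall>k\<in>P \<rightarrow>\<^sub>E S. restrict (ext k) P = k"
    proof
      fix k assume k: "k \<in> P \<rightarrow>\<^sub>E S"
      show "restrict (ext k) P = k"
      proof
        fix x
        show "restrict (ext k) P x = k x"
          using k P(1,2) by (cases "x \<in> P") (auto simp: ext_def)
      qed
    qed
    show "(\<lambda>h. restrict h P) ` ?X \<subseteq> P \<rightarrow>\<^sub>E S" using P(1) by auto
    show "ext ` (P \<rightarrow>\<^sub>E S) \<subseteq> ?X"
    proof (rule image_subsetI)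
      fix k assume k: "k \<in> P \<rightarrow>\<^sub>E S"
      have "ext k x \<in> S" if "x \<in> carrier G" for x
        using that k P(4)[of x] \<sigma>(1) e by (auto simp: ext_def)
      then have "ext k \<in> carrier G \<rightarrow>\<^sub>E S" by (auto simp: ext_def)
      moreover have "ext k (inv x) = \<sigma> (ext k x)" if x: "x \<in> carrier G" for x
      proof -
        \<comment> \<open>This settles the case where \<open>x\<close> lies outside
          \<open>P\<close>. There \<open>ext k x\<close> carries one \<open>\<sigma>\<close>, which
          a second one undoes; at the identity \<open>\<sigma> e = e\<close> is what
          matters.\<close>
        have "\<sigma> (\<sigma> (k y)) = k y" if "y \<in> P" for y using that k \<sigma>(2) by auto
        then show ?thesis using x P(4)[of x] e by (auto simp: ext_def inv_eq_1_iff)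
      qed
      ultimately show "ext k \<in> ?X" by (auto simp: ext_def)
    qed
  qed
  then have "card ?X = card (P \<rightarrow>\<^sub>E S)" by (rule bij_betw_same_card)
  also have "\<dots> = card S ^ card P" using fin P(1) by (intro card_funcsetE) (auto intro: finite_subset)
  finally show ?thesis using P(3) by simp
qed

section \<open>Orders of the symmetric and unitary groups\<close>

context group_pairing
begin

text \<open>By bijectivity, elements of \<open>A\<close> cut out by a condition on their transforms
  can be counted as functions satisfying that condition.\<close>

lemma card_via_fourier:
  assumes "H \<subseteq> carrier A"
  shows "card {u \<in> carrier A. fourier u \<in> H} = card H"
proof -
  have "H \<subseteq> fourier ` carrier A" using bij_betw_fourier assms by (simp add: bij_betw_def)
  then have image: "fourier ` {u \<in> carrier A. fourier u \<in> H} = H" by auto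
  have "inj_on fourier {u \<in> carrier A. fourier u \<in> H}"
    by (rule inj_on_subset[OF inj_fourier]) auto
  from card_image[OF this] show ?thesis unfolding image by (rule sym)
qed

lemma PiE_Units_subset: "carrier B \<rightarrow>\<^sub>E Units R \<subseteq> carrier A"
  unfolding carrier_A by (intro PiE_mono subsetI Units_closed)

text \<open>Nonvanishing is recast as membership in a function space with values in
  \<open>Units R\<close>, the form that the count of equivariant functions expects.\<close>

lemma normalized_units_iff:
  "u \<in> carrier (normalized_units R B) \<longleftrightarrow>
    u \<in> carrier A \<and> fourier u \<in> carrier B \<rightarrow>\<^sub>E Units R \<and> fourier u \<one>\<^bsub>B\<^esub> = \<one>"
proof (cases "u \<in> carrier A")
  case True
  then have "fourier u \<in> carrier B \<rightarrow>\<^sub>E carrier R" using fourier_closed carrier_A by blast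
  then have "fourier u \<in> carrier B \<rightarrow>\<^sub>E Units R \<longleftrightarrow> (\<forall>y\<in>carrier B. fourier u y \<noteq> \<zero>)"
    by (auto simp: PiE_iff field_Units)
  then show ?thesis by (simp add: carrier_normalized_units True)
qed (simp add: carrier_normalized_units)

lemma order_symmetric_units:
  assumes "odd (order B)"
  shows "order (symmetric_units R B) = order (units_of R) ^ ((order B - 1) div 2)"
proof -
  let ?H = "{h \<in> carrier B \<rightarrow>\<^sub>E Units R. h \<one>\<^bsub>B\<^esub> = \<one> \<and> (\<forall>y\<in>carrier B. h (inv\<^bsub>B\<^esub> y) = h y)}"
  have "carrier (symmetric_units R B) = {u \<in> carrier A. fourier u \<in> ?H}"
    by (rule Set.set_eqI) (simp only: symmetric_units_iff normalized_units_iff mem_Collect_eq conj_assoc)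
  also have "card \<dots> = card ?H"
    by (rule card_via_fourier) (use PiE_Units_subset in blast)
  also have "\<dots> = card (Units R) ^ ((order B - 1) div 2)"
    using B.card_inv_equivariant[OF finite_B assms, of "Units R" "\<lambda>s. s" \<one>] by simp
  finally show ?thesis by (simp add: order_def units_of_carrier)
qed

lemma order_unitary_units:
  assumes "odd (order B)"
  shows "order (unitary_units R B) = order (units_of R) ^ ((order B - 1) div 2)"
proof -
  let ?H = "{h \<in> carrier B \<rightarrow>\<^sub>E Units R. h \<one>\<^bsub>B\<^esub> = \<one> \<and> (\<forall>y\<in>carrier B. h (inv\<^bsub>B\<^esub> y) = inv (h y))}"
  have "carrier (unitary_units R B) = {u \<in> carrier A. fourier u \<in> ?H}"
    by (rule Set.set_eqI) (simp only: unitary_units_iff normalized_units_iff mem_Collect_eq conj_assoc)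
  also have "card \<dots> = card ?H"
    by (rule card_via_fourier) (use PiE_Units_subset in blast)
  also have "\<dots> = card (Units R) ^ ((order B - 1) div 2)"
    using B.card_inv_equivariant[OF finite_B assms, of "Units R" "\<lambda>s. inv s" \<one>] by simp
  finally show ?thesis by (simp add: order_def units_of_carrier)
qed

end


section \<open>The odd part of an abelian group with an involution\<close>

lemma (in group) ord_subgroup:
  "group.ord (G\<lparr>carrier := H\<rparr>) x = ord x" if "subgroup H G"
  using that group.ord_def[OF subgroup_imp_group[OF that]]
  by (simp add: ord_def nat_pow_consistent[symmetric])

lemma (in comm_group) comm_group_subgroup: "subgroup H G \<Longrightarrow> comm_group (G\<lparr>carrier := H\<rparr>)"
  by (rule group.group_comm_groupI) (auto simp: subgroup_imp_group subgroup.mem_carrier m_comm)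

text \<open>Orders of elements do not change on passing to a subgroup, so every odd part below is an
  intersection with the odd part of \<open>G\<close>.\<close>

lemma (in comm_group) hall_odd_subgroup:
  assumes "finite (carrier G)" "subgroup H G"
  shows "hall_odd (G\<lparr>carrier := H\<rparr>) = {x \<in> H. odd (ord x)}"
  using hall_odd_eq(1)[OF comm_group_subgroup[OF assms(2)]] assms
  by (auto simp: ord_subgroup intro: finite_subset[OF subgroup.subset])

lemma (in comm_group) subgroup_hall_odd:
  "finite (carrier G) \<Longrightarrow> subgroup (hall_odd G) G"
  using hall_odd_eq[OF comm_group_axioms] unfolding hall_subgroup_def by metis

lemma (in comm_group) hall_odd_involution_decomposition:
  assumes fin: "finite (carrier G)" and hom: "\<sigma> \<in> hom G G"
    and invol: "\<And>x. x \<in> carrier G \<Longrightarrow> \<sigma> (\<sigma> x) = x"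
  shows "internal_direct_product (G\<lparr>carrier := hall_odd G\<rparr>)
    (hall_odd (G\<lparr>carrier := {x \<in> carrier G. \<sigma> x = x}\<rparr>))
    (hall_odd (G\<lparr>carrier := {x \<in> carrier G. \<sigma> x = inv x}\<rparr>))"
proof -
  interpret \<sigma>: group_hom G G \<sigma>
    using hom by unfold_locales
  let ?S = "{x \<in> carrier G. \<sigma> x = x}" and ?U = "{x \<in> carrier G. \<sigma> x = inv x}"
  let ?O = "hall_odd G"
  have S: "subgroup ?S G" and U: "subgroup ?U G"
    by (rule subgroupI; force simp: inv_mult)+
  have O: "?O = {x \<in> carrier G. odd (ord x)}"
    using hall_odd_eq(1)[OF comm_group_axioms fin] .
  have O_sub: "subgroup ?O G" by (rule subgroup_hall_odd[OF fin])
  have OS: "hall_odd (G\<lparr>carrier := ?S\<rparr>) = ?S \<inter> ?O" and OU: "hall_odd (G\<lparr>carrier := ?U\<rparr>) = ?U \<inter> ?O"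
    using hall_odd_subgroup[OF fin S] hall_odd_subgroup[OF fin U] O by auto
  interpret O: comm_group "G\<lparr>carrier := ?O\<rparr>" by (rule comm_group_subgroup[OF O_sub])
  \<comment> \<open>A homomorphism can only shrink the order of an element to a divisor, so the odd
    part is stable under \<open>\<sigma>\<close>.\<close>
  have \<sigma>_O: "\<sigma> x \<in> ?O" if "x \<in> ?O" for x
  proof -
    have x: "x \<in> carrier G" "odd (ord x)" using that O by auto
    have "\<sigma> x [^] ord x = \<one>" using x \<sigma>.hom_nat_pow[of x "ord x"] by simp
    then have "ord (\<sigma> x) dvd ord x" using pow_eq_id[of "\<sigma> x" "ord x"] x(1) by simp
    then have "odd (ord (\<sigma> x))" using x(2) dvd_trans by blast
    then show ?thesis unfolding O using x(1) by simp
  qed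
  have normal: "H \<inter> ?O \<lhd> G\<lparr>carrier := ?O\<rparr>" if "subgroup H G" for H
    by (intro O.subgroup_imp_normal subgroup_incl subgroups_Inter_pair that O_sub) auto
  \<comment> \<open>On the intersection \<open>\<sigma> x\<close> is both \<open>x\<close> and its
    inverse, so \<open>x\<close> is a self-inverse element of odd order.\<close>
  have "(?S \<inter> ?O) \<inter> (?U \<inter> ?O) = {\<one>}"
  proof (intro subset_antisym subsetI)
    fix x assume "x \<in> (?S \<inter> ?O) \<inter> (?U \<inter> ?O)"
    then have x: "x \<in> carrier G" "inv x = x" "odd (ord x)" unfolding O by auto
    then show "x \<in> {\<one>}" using eq_one_if_odd_ord_self_inverse by blast
  qed (use subgroup.one_closed[OF O_sub] in auto)
  moreover have "(?S \<inter> ?O) <#> (?U \<inter> ?O) = ?O"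
  proof (intro subset_antisym subsetI)
    fix x assume "x \<in> (?S \<inter> ?O) <#> (?U \<inter> ?O)"
    then show "x \<in> ?O" using subgroup.m_closed[OF O_sub] by (auto simp: set_mult_def)
  next
    fix x assume x: "x \<in> ?O"
    then have xc: "x \<in> carrier G" "odd (ord x)" using O by auto
    then obtain m where m: "ord x = 2 * m + 1" by (auto elim: oddE)
    \<comment> \<open>The exponent \<open>m + 1\<close> inverts 2 modulo
      \<open>ord x = 2 * m + 1\<close>, so \<open>r\<close> is a square root of \<open>x\<close>; as
      a power of \<open>x\<close> it stays in the odd part.\<close>
    define r where "r = x [^] (m + 1)"
    have r: "r \<in> carrier G" "r \<in> ?O"
      using xc O.nat_pow_closed[of x "m + 1"] x by (auto simp: r_def nat_pow_consistent[symmetric])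
    have rr: "r \<otimes> r = x"
    proof -
      have "r \<otimes> r = x [^] ((m + 1) + (m + 1))" unfolding r_def using xc(1) by (rule nat_pow_mult)
      also have "(m + 1) + (m + 1) = Suc (ord x)" using m by simp
      also have "x [^] Suc (ord x) = x" using xc(1) by simp
      finally show ?thesis .
    qed
    have s: "\<sigma> r \<in> carrier G" "\<sigma> r \<in> ?O" "\<sigma> (\<sigma> r) = r"
      using r(1) invol[OF r(1)] \<sigma>_O[OF r(2)] by simp_all
    have "r \<otimes> \<sigma> r \<in> ?O" "r \<otimes> inv (\<sigma> r) \<in> ?O"
      using subgroup.m_closed[OF O_sub r(2)] s(2) subgroup.m_inv_closed[OF O_sub s(2)] by blast+
    \<comment> \<open>Applying \<open>\<sigma>\<close> exchanges \<open>r\<close> and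
      \<open>\<sigma> r\<close>: this fixes their product and inverts their quotient.\<close>
    moreover have "r \<otimes> \<sigma> r \<in> ?S" using r(1) s m_comm[OF r(1) s(1)] by simp
    moreover have "r \<otimes> inv (\<sigma> r) \<in> ?U" using r(1) s m_comm[of "inv r" "\<sigma> r"] by (simp add: inv_mult)
    ultimately have "r \<otimes> \<sigma> r \<in> ?S \<inter> ?O" "r \<otimes> inv (\<sigma> r) \<in> ?U \<inter> ?O" by blast+
    moreover have "(r \<otimes> \<sigma> r) \<otimes> (r \<otimes> inv (\<sigma> r)) = x"
    proof -
      have "(r \<otimes> \<sigma> r) \<otimes> (r \<otimes> inv (\<sigma> r)) = (r \<otimes> r) \<otimes> (\<sigma> r \<otimes> inv (\<sigma> r))"
        using r(1) s(1) by (simp only: m_ac m_closed inv_closed)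
      then show ?thesis using rr s(1) xc(1) by simp
    qed
    ultimately show "x \<in> (?S \<inter> ?O) <#> (?U \<inter> ?O)" unfolding set_mult_def by blast
  qed
  moreover have "\<one>\<^bsub>G\<lparr>carrier := ?O\<rparr>\<^esub> = \<one>" "carrier (G\<lparr>carrier := ?O\<rparr>) = ?O" by simp_all
  ultimately show ?thesis
    unfolding internal_direct_product_def OS OU set_mult_consistent
    using normal[OF S] normal[OF U] by metis
qed


section \<open>Cyclic groups\<close>

text \<open>The exponents are compared in the integers because subtraction of naturals
  truncates.\<close>

lemma (in group) nat_pow_eq_iff_cong:
  assumes "x \<in> carrier G"
  shows "x [^] (m::nat) = x [^] (n::nat) \<longleftrightarrow> int (ord x) dvd (int n - int m)"
  using int_pow_eq[OF assms, of "int m" "int n"] by (simp add: int_pow_int)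

lemma nat_pow_units_of: "x [^]\<^bsub>units_of R\<^esub> (n::nat) = x [^]\<^bsub>R\<^esub> n"
  by (simp add: units_of_def nat_pow_def)

lemma group_pairing_cyclic:
  assumes R: "field R" "finite (carrier R)" and B: "group B" "b \<in> carrier B" "carrier B = generate B {b}"
    and q: "order B = q" "prime q" "q dvd card (carrier R) - 1"
  shows "\<exists>\<chi>. group_pairing R B \<chi>"
proof -
  interpret R: field R by (rule R(1))
  interpret B: group B by (rule B(1))
  interpret U: comm_group "units_of R" by (rule R.units_comm_group)
  have finB: "finite (carrier B)"
    using q prime_gt_0_nat[of q] by (auto simp: order_def intro: card_ge_0_finite)
  have ordb: "B.ord b = q" using B.generate_pow_card[OF B(2)] B(3) q(1) by (simp add: order_def)
  have card_U: "order (units_of R) = card (carrier R) - 1"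
    using R(2) by (simp add: order_def units_of_carrier R.field_Units)
  \<comment> \<open>Cauchy's theorem in the group of units, whose order is divisible by
    \<open>q\<close>, yields a primitive \<open>q\<close>-th root of unity.\<close>
  obtain w where w: "w \<in> Units R" "U.ord w = q"
    using U.exists_ord_prime[of q] q card_U R(2) by (auto simp: units_of_carrier R.field_Units)
  have wR: "w \<in> carrier R" using w by auto
  \<comment> \<open>As \<open>w\<close> and \<open>b\<close> have the same order, their powers
    coincide for the same pairs of exponents. This makes the choice of logarithms below
    harmless.\<close>
  have w_eq: "w [^]\<^bsub>R\<^esub> m = w [^]\<^bsub>R\<^esub> n \<longleftrightarrow> b [^]\<^bsub>B\<^esub> m = b [^]\<^bsub>B\<^esub> n" for m n :: nat
    using U.nat_pow_eq_iff_cong[of w m n] B.nat_pow_eq_iff_cong[OF B(2), of m n] w ordb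
    by (simp add: units_of_carrier nat_pow_units_of)
  \<comment> \<open>A discrete logarithm \<open>l\<close> to base \<open>b\<close> is chosen
    arbitrarily. It need be additive only modulo \<open>q\<close>, which is enough after
    exponentiating \<open>w\<close>.\<close>
  have "\<exists>k::nat. b [^]\<^bsub>B\<^esub> k = x" if "x \<in> carrier B" for x
    using that B(3) B.generate_pow_on_finite_carrier[OF finB B(2)] by auto
  then obtain l :: "_ \<Rightarrow> nat" where l: "\<And>x. x \<in> carrier B \<Longrightarrow> b [^]\<^bsub>B\<^esub> l x = x" by metis
  define \<chi> where "\<chi> x y = w [^]\<^bsub>R\<^esub> (l x * l y)" for x y
  have l_mult: "w [^]\<^bsub>R\<^esub> l (x \<otimes>\<^bsub>B\<^esub> y) = w [^]\<^bsub>R\<^esub> l x \<otimes>\<^bsub>R\<^esub> w [^]\<^bsub>R\<^esub> l y"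
    if "x \<in> carrier B" "y \<in> carrier B" for x y
    using that wR w_eq[of "l (x \<otimes>\<^bsub>B\<^esub> y)" "l x + l y"] B(2)
    by (simp add: l B.nat_pow_mult[symmetric] R.nat_pow_mult)
  have l_one: "w [^]\<^bsub>R\<^esub> l \<one>\<^bsub>B\<^esub> = \<one>\<^bsub>R\<^esub>" using w_eq[of "l \<one>\<^bsub>B\<^esub>" 0] by (simp add: l)
  have l_b: "w [^]\<^bsub>R\<^esub> l b = w" using w_eq[of "l b" 1] wR B(2) by (simp add: l)
  have comm: "comm_group B"
  proof (rule B.group_comm_groupI)
    fix x y assume "x \<in> carrier B" "y \<in> carrier B"
    then show "x \<otimes>\<^bsub>B\<^esub> y = y \<otimes>\<^bsub>B\<^esub> x"
      using B.nat_pow_mult[OF B(2), of "l x" "l y"] B.nat_pow_mult[OF B(2), of "l y" "l x"]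
      by (simp add: l add.commute)
  qed
  \<comment> \<open>The additive group of \<open>R\<close> has order \<open>q * k + 1\<close>, which
    annihilates 1. If \<open>q\<close> annihilated 1 as well, then 1 would be 0.\<close>
  have nonzero: "[q] \<cdot>\<^bsub>R\<^esub> \<one>\<^bsub>R\<^esub> \<noteq> \<zero>\<^bsub>R\<^esub>"
  proof
    assume 0: "[q] \<cdot>\<^bsub>R\<^esub> \<one>\<^bsub>R\<^esub> = \<zero>\<^bsub>R\<^esub>"
    obtain k where k: "card (carrier R) - 1 = q * k" using q(3) by blast
    have "card (carrier R) \<noteq> 0" using R(2) by auto
    then have N: "card (carrier R) = q * k + 1" using k by simp
    have "[card (carrier R)] \<cdot>\<^bsub>R\<^esub> \<one>\<^bsub>R\<^esub> = \<zero>\<^bsub>R\<^esub>"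
      using R.add.pow_order_eq_1[of "\<one>\<^bsub>R\<^esub>"] by (simp add: order_def)
    moreover have "[(q * k)] \<cdot>\<^bsub>R\<^esub> \<one>\<^bsub>R\<^esub> = \<zero>\<^bsub>R\<^esub>"
      using R.add.nat_pow_pow[of "\<one>\<^bsub>R\<^esub>" k q] 0 by (simp add: mult.commute)
    ultimately show False
      using R.add.nat_pow_mult[of "\<one>\<^bsub>R\<^esub>" "q * k" 1] N by simp
  qed
  have "group_pairing R B \<chi>"
  proof (intro group_pairing.intro group_pairing_axioms.intro R(1) comm R(2) finB)
    fix x y assume x: "x \<in> carrier B" and y: "y \<in> carrier B"
    show "\<chi> x y \<in> carrier R" using wR by (simp add: \<chi>_def)
    show "\<chi> x y = \<chi> y x" by (simp add: \<chi>_def mult.commute)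
    fix z
    show "\<chi> (x \<otimes>\<^bsub>B\<^esub> y) z = \<chi> x z \<otimes>\<^bsub>R\<^esub> \<chi> y z"
      using x y wR by (simp add: \<chi>_def R.nat_pow_pow[symmetric] l_mult R.nat_pow_distrib)
  next
    fix y assume "y \<in> carrier B"
    show "\<chi> \<one>\<^bsub>B\<^esub> y = \<one>\<^bsub>R\<^esub>" using wR by (simp add: \<chi>_def R.nat_pow_pow[symmetric] l_one)
  next
    fix y assume y: "y \<in> carrier B" "y \<noteq> \<one>\<^bsub>B\<^esub>"
    \<comment> \<open>The generator \<open>b\<close> detects every nontrivial \<open>y\<close>,
      since pairing with it gives \<open>w\<close> to the power \<open>l y\<close>.\<close>
    have "\<chi> b y = w [^]\<^bsub>R\<^esub> l y" using wR by (simp add: \<chi>_def R.nat_pow_pow[symmetric] l_b)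
    then have "\<chi> b y \<noteq> \<one>\<^bsub>R\<^esub>" using y w_eq[of "l y" 0] by (simp add: l)
    then show "\<exists>x\<in>carrier B. \<chi> x y \<noteq> \<one>\<^bsub>R\<^esub>" using B(2) by blast
  qed (simp add: q(1) nonzero)
  then show ?thesis by blast
qed

theorem proposition2p1:
  fixes F :: "('a, 'm) ring_scheme"
    and B :: "('g, 'n) monoid_scheme"
    and b :: 'g
    and p f q :: nat
  assumes "field F"
    and "prime p" and "card (carrier F) = p ^ f" and "p ^ f > 3"
    and "prime q" and "odd q" and "q dvd p ^ f - 1"
    and "group B" and "b \<in> carrier B" and "carrier B = generate B {b}" and "order B = q"
  shows "order (symmetric_units F B) = order (unitary_units F B) \<and>
    order (unitary_units F B) = order (units_of F) ^ ((q - 1) div 2) \<and>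
    internal_direct_product
           ((normalized_units F B)\<lparr>carrier := hall_odd (normalized_units F B)\<rparr>)
           (hall_odd (symmetric_units F B)) (hall_odd (unitary_units F B))"
proof -
  \<comment> \<open>An infinite set has \<open>card\<close> equal to 0, so the positive cardinality
    forces finiteness.\<close>
  have "finite (carrier F)" using assms(3,4) by (intro card_ge_0_finite) linarith
  then obtain \<chi> where "group_pairing F B \<chi>"
    using group_pairing_cyclic[of F B b q] assms by auto
  then interpret group_pairing F B \<chi> .
  interpret V: comm_group "normalized_units F B" by (rule comm_group_normalized_units)
  have "internal_direct_product
       ((normalized_units F B)\<lparr>carrier := hall_odd (normalized_units F B)\<rparr>)
       (hall_odd (symmetric_units F B)) (hall_odd (unitary_units F B))"
    \<comment> \<open>Unfolded, the two groups are the subgroups on which the involution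
      \<open>star B\<close> acts as the identity and as inversion.\<close>
    unfolding symmetric_units_def unitary_units_def
    by (rule V.hall_odd_involution_decomposition[OF finite_normalized_units star_hom])
      (auto simp: carrier_normalized_units star_star)
  then show ?thesis
    using order_symmetric_units order_unitary_units assms(6,11) by simp
qed

end
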